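(* If there is an algorithm that, given any hypergraph $H$ with a correspondence $\tau$, enumerates all minimal Roman hitting functions of $(H,\tau)$ with polynomial delay, then there is an algorithm that, given any hypergraph $H'$, enumerates all minimal hitting sets of $H'$ with polynomial delay.
   Context: A hypergraph is $H=(X,(s_i)_{i\in I})$ with finite $X$, finite index set $I$, $s_i\subseteq X$ (repetitions allowed). A correspondence is a map $\tau:X\to I$ with $x\in s_{\tau(x)}$ for all $x$. A function $g:X\to\{0,1,2\}$ is a Roman hitting function (rhf) if for every $i\in I$ there is $x\in s_i$ with $g(x)=2$ or there is $x$ with $\tau(x)=i$ and $g(x)=1$; functions are ordered pointwise and an rhf $g$ is minimal if every rhf $h\le g$ equals $g$. A hitting set of a hypergraph is a set of vertices meeting every hyperedge; it is minimal if no proper subset is a hitting set. An enumeration algorithm has polynomial delay if the time before the first output, between consecutive outputs, and after the last output until termination is polynomial in the input size. *)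

theory Defs
  imports "HOL-Library.FuncSet" "HOL-Computational_Algebra.Polynomial"
begin

section \<open>Hypergraphs and Roman hitting functions\<close>

text \<open>The family \<open>(s\<^sub>i)\<close> is the function \<open>edge\<close>, of which only the values on \<open>idx\<close> matter.\<close>

record ('x, 'i) hypergraph =
  verts :: "'x set"
  idx :: "'i set"
  edge :: "'i \<Rightarrow> 'x set"

definition is_hypergraph :: "('x, 'i) hypergraph \<Rightarrow> bool" where
  "is_hypergraph H \<longleftrightarrow>
     finite (verts H) \<and> finite (idx H) \<and> (\<forall>i\<in>idx H. edge H i \<subseteq> verts H)"

definition correspondence :: "('x, 'i) hypergraph \<Rightarrow> ('x \<Rightarrow> 'i) \<Rightarrow> bool" where
  "correspondence H \<tau> \<longleftrightarrow> \<tau> \<in> verts H \<rightarrow> idx H \<and> (\<forall>x\<in>verts H. x \<in> edge H (\<tau> x))"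

text \<open>Functions on the vertex set are extensional, so that equality of functions on the type is
  equality on the vertex set.\<close>

definition rhf :: "('x, 'i) hypergraph \<Rightarrow> ('x \<Rightarrow> 'i) \<Rightarrow> ('x \<Rightarrow> nat) \<Rightarrow> bool" where
  "rhf H \<tau> g \<longleftrightarrow>
     g \<in> verts H \<rightarrow>\<^sub>E {0, 1, 2} \<and>
     (\<forall>i\<in>idx H. (\<exists>x\<in>edge H i. g x = 2) \<or> (\<exists>x\<in>verts H. \<tau> x = i \<and> g x = 1))"

definition minimal_rhf :: "('x, 'i) hypergraph \<Rightarrow> ('x \<Rightarrow> 'i) \<Rightarrow> ('x \<Rightarrow> nat) \<Rightarrow> bool" where
  "minimal_rhf H \<tau> g \<longleftrightarrow>
     rhf H \<tau> g \<and> (\<forall>h. rhf H \<tau> h \<and> (\<forall>x\<in>verts H. h x \<le> g x) \<longrightarrow> h = g)"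

definition hitting_set :: "('x, 'i) hypergraph \<Rightarrow> 'x set \<Rightarrow> bool" where
  "hitting_set H S \<longleftrightarrow> S \<subseteq> verts H \<and> (\<forall>i\<in>idx H. edge H i \<inter> S \<noteq> {})"

definition minimal_hitting_set :: "('x, 'i) hypergraph \<Rightarrow> 'x set \<Rightarrow> bool" where
  "minimal_hitting_set H S \<longleftrightarrow> hitting_set H S \<and> (\<forall>T. T \<subset> S \<longrightarrow> \<not> hitting_set H T)"


section \<open>Algorithms\<close>

text \<open>Algorithms are while-programs over finitely many stacks. A program is a finite object that
  inspects and writes symbols only by naming them, so each program uses finitely many stacks and a
  finite work alphabet. Since two stacks are a Turing machine tape, and a finite control can be kept
  as the top symbol of one further stack, these programs and multi-tape Turing machines simulate
  each other with a constant number of steps per step. The command \<open>Emit r\<close> outputs the whole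
  content of stack \<open>r\<close>, leaving it unchanged; it corresponds to entering an output state.\<close>

type_synonym word = "nat list"
type_synonym store = "nat \<Rightarrow> word"

datatype test = Empty nat | Top nat nat | Neg test

fun holds :: "test \<Rightarrow> store \<Rightarrow> bool" where
  "holds (Empty r) s \<longleftrightarrow> s r = []"
| "holds (Top r a) s \<longleftrightarrow> (\<exists>w. s r = a # w)"
| "holds (Neg b) s \<longleftrightarrow> \<not> holds b s"

datatype prog =
    SKIP
  | Push nat nat
  | Pop nat
  | Emit nat
  | Seq prog prog
  | Cond test prog prog
  | While test prog

datatype event = Tick | Output word

text \<open>\<open>exec c s tr s'\<close>: started in \<open>s\<close>, program \<open>c\<close> halts in \<open>s'\<close>, and \<open>tr\<close> is the chronological
  sequence of its computation steps and outputs. Every elementary command and every evaluation of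
  a test takes one step.\<close>

inductive exec :: "prog \<Rightarrow> store \<Rightarrow> event list \<Rightarrow> store \<Rightarrow> bool" where
  exec_SKIP: "exec SKIP s [Tick] s"
| exec_Push: "exec (Push r a) s [Tick] (s(r := a # s r))"
| exec_Pop: "exec (Pop r) s [Tick] (s(r := tl (s r)))"
| exec_Emit: "exec (Emit r) s [Tick, Output (s r)] s"
| exec_Seq: "exec c1 s tr1 s1 \<Longrightarrow> exec c2 s1 tr2 s2 \<Longrightarrow> exec (Seq c1 c2) s (tr1 @ tr2) s2"
| exec_CondT: "holds b s \<Longrightarrow> exec c1 s tr s1 \<Longrightarrow> exec (Cond b c1 c2) s (Tick # tr) s1"
| exec_CondF: "\<not> holds b s \<Longrightarrow> exec c2 s tr s1 \<Longrightarrow> exec (Cond b c1 c2) s (Tick # tr) s1"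
| exec_WhileF: "\<not> holds b s \<Longrightarrow> exec (While b c) s [Tick] s"
| exec_WhileT: "holds b s \<Longrightarrow> exec c s tr1 s1 \<Longrightarrow> exec (While b c) s1 tr2 s2 \<Longrightarrow>
    exec (While b c) s (Tick # tr1 @ tr2) s2"

inductive_cases exec_SKIP_E: "exec SKIP s tr s'"
inductive_cases exec_Push_E: "exec (Push r a) s tr s'"
inductive_cases exec_Pop_E: "exec (Pop r) s tr s'"
inductive_cases exec_Emit_E: "exec (Emit r) s tr s'"
inductive_cases exec_Seq_E: "exec (Seq c1 c2) s tr s'"
inductive_cases exec_Cond_E: "exec (Cond b c1 c2) s tr s'"
inductive_cases exec_While_E: "exec (While b c) s tr s'"

lemma exec_deterministic:
  "exec c s tr s1 \<Longrightarrow> exec c s tr' s1' \<Longrightarrow> tr' = tr \<and> s1' = s1"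
proof (induction arbitrary: tr' s1' rule: exec.induct)
  case (exec_SKIP s)
  then show ?case by (auto elim: exec_SKIP_E)
next
  case (exec_Push r a s)
  then show ?case by (auto elim: exec_Push_E)
next
  case (exec_Pop r s)
  then show ?case by (auto elim: exec_Pop_E)
next
  case (exec_Emit r s)
  then show ?case by (auto elim: exec_Emit_E)
next
  case (exec_Seq c1 s tr1 s1 c2 tr2 s2)
  from exec_Seq.prems show ?case by (rule exec_Seq_E) (use exec_Seq.IH in blast)
next
  case (exec_CondT b s c1 tr s1 c2)
  from exec_CondT.prems show ?case
    by (rule exec_Cond_E) (use exec_CondT.IH exec_CondT.hyps in blast)+
next
  case (exec_CondF b s c2 tr s1 c1)
  from exec_CondF.prems show ?case
    by (rule exec_Cond_E) (use exec_CondF.IH exec_CondF.hyps in blast)+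
next
  case (exec_WhileF b s c)
  from exec_WhileF.prems show ?case
    by (rule exec_While_E) (use exec_WhileF.hyps in blast)+
next
  case (exec_WhileT b s c tr1 s1 tr2 s2)
  from exec_WhileT.prems show ?case
    by (rule exec_While_E) (use exec_WhileT.IH exec_WhileT.hyps in blast)+
qed

definition init :: "word \<Rightarrow> store" where
  "init w = (\<lambda>_. [])(0 := w)"

fun outputs :: "event list \<Rightarrow> word list" where
  "outputs [] = []"
| "outputs (Tick # tr) = outputs tr"
| "outputs (Output w # tr) = w # outputs tr"

text \<open>The numbers of steps before the first output, between consecutive outputs, and from the last
  output to termination, in this order; \<open>d\<close> counts the steps since the last output.\<close>

fun delays_from :: "nat \<Rightarrow> event list \<Rightarrow> nat list" where
  "delays_from d [] = [d]"
| "delays_from d (Tick # tr) = delays_from (Suc d) tr"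
| "delays_from d (Output w # tr) = d # delays_from 0 tr"

definition delays :: "event list \<Rightarrow> nat list" where
  "delays tr = delays_from 0 tr"

text \<open>An enumeration problem is given by its set \<open>P\<close> of instances, the input word \<open>enc a\<close> of an
  instance \<open>a\<close>, and the set \<open>sols a\<close> of its (encoded) solutions, each of which has to be output
  exactly once.\<close>

definition enumerates_poly_delay ::
    "prog \<Rightarrow> 'a set \<Rightarrow> ('a \<Rightarrow> word) \<Rightarrow> ('a \<Rightarrow> word set) \<Rightarrow> bool" where
  "enumerates_poly_delay c P enc sols \<longleftrightarrow>
     (\<exists>p :: nat poly. \<forall>a\<in>P. \<exists>tr s'.
        exec c (init (enc a)) tr s' \<and>
        distinct (outputs tr) \<and> set (outputs tr) = sols a \<and>
        (\<forall>d\<in>set (delays tr). d \<le> poly p (length (enc a))))"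


section \<open>The two enumeration problems\<close>

text \<open>Input hypergraphs have natural numbers as vertices and indices. As usual the names do not
  enter the input: vertices and indices are listed in increasing order and a hypergraph is given by
  its number of vertices in unary and its incidence matrix, one row per index. A correspondence is
  given by the 0-1-matrix of the relation \<open>\<tau> x = i\<close>. The symbols 2 and 3 end rows and matrices.\<close>

type_synonym nhypergraph = "(nat, nat) hypergraph"

definition enc_matrix :: "nhypergraph \<Rightarrow> (nat \<Rightarrow> nat \<Rightarrow> bool) \<Rightarrow> word" where
  "enc_matrix H R =
     concat (map (\<lambda>i. map (\<lambda>x. if R i x then 1 else 0) (sorted_list_of_set (verts H)) @ [2])
       (sorted_list_of_set (idx H))) @ [3]"

definition enc_hypergraph :: "nhypergraph \<Rightarrow> word" where
  "enc_hypergraph H =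
     replicate (card (verts H)) 1 @ [2] @ enc_matrix H (\<lambda>i x. x \<in> edge H i)"

definition enc_hypergraph_corr :: "nhypergraph \<times> (nat \<Rightarrow> nat) \<Rightarrow> word" where
  "enc_hypergraph_corr = (\<lambda>(H, \<tau>). enc_hypergraph H @ enc_matrix H (\<lambda>i x. \<tau> x = i))"

definition enc_fun :: "nhypergraph \<Rightarrow> (nat \<Rightarrow> nat) \<Rightarrow> word" where
  "enc_fun H g = map g (sorted_list_of_set (verts H))"

definition enc_set :: "nhypergraph \<Rightarrow> nat set \<Rightarrow> word" where
  "enc_set H S = map (\<lambda>x. if x \<in> S then 1 else 0) (sorted_list_of_set (verts H))"

definition poly_delay_enumerates_minimal_rhfs :: "prog \<Rightarrow> bool" where
  "poly_delay_enumerates_minimal_rhfs c \<longleftrightarrow>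
     enumerates_poly_delay c
       {(H, \<tau>). is_hypergraph H \<and> correspondence H \<tau>}
       enc_hypergraph_corr
       (\<lambda>(H, \<tau>). enc_fun H ` {g. minimal_rhf H \<tau> g})"

definition poly_delay_enumerates_minimal_hitting_sets :: "prog \<Rightarrow> bool" where
  "poly_delay_enumerates_minimal_hitting_sets c \<longleftrightarrow>
     enumerates_poly_delay c
       {H. is_hypergraph H}
       enc_hypergraph
       (\<lambda>H. enc_set H ` {S. minimal_hitting_set H S})"

end

theory Submission
  imports Defs
begin

text \<open>Adding to a hypergraph with at least one edge the edge \<open>e\<close> consisting of all vertices, and
  letting every vertex correspond to \<open>e\<close>, makes the value 1 useless: a function is a Roman hitting
  function iff the vertices of value 2 hit all the original edges, as they then hit \<open>e\<close> as well.
  So the minimal Roman hitting functions are the functions \<open>2 \<cdot> 1\<^sub>S\<close> with \<open>S\<close> a minimal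
  hitting set. Hence it suffices to prepare the enlarged input, run the given program on it, and
  rewrite each output in linear time, which adds a linear term to the delay. Without edges, the
  only minimal hitting set is empty and is output directly.\<close>

section \<open>The reduction\<close>

text \<open>The edge \<open>e\<close> contains every vertex, so the constant map to \<open>e\<close>
  is a correspondence even if some vertices lie in no edge of \<open>H\<close>. It becomes a further
  edge once \<open>e\<close> is chosen outside \<open>idx H\<close>.\<close>

definition add_full_edge :: "('x, nat) hypergraph \<Rightarrow> nat \<Rightarrow> ('x, nat) hypergraph" where
  "add_full_edge H e = \<lparr>verts = verts H, idx = insert e (idx H), edge = (edge H)(e := verts H)\<rparr>"

definition twice_indicator :: "('x, 'i) hypergraph \<Rightarrow> 'x set \<Rightarrow> 'x \<Rightarrow> nat" where
  "twice_indicator H S = (\<lambda>x\<in>verts H. if x \<in> S then 2 else 0)"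

lemma is_hypergraph_add_full_edge:
  "is_hypergraph H \<Longrightarrow> is_hypergraph (add_full_edge H e)"
  by (auto simp: is_hypergraph_def add_full_edge_def)

lemma correspondence_add_full_edge: "correspondence (add_full_edge H e) (\<lambda>_. e)"
  by (auto simp: correspondence_def add_full_edge_def)

text \<open>A value 1 can only serve the index \<open>e\<close>. Since \<open>idx H\<close> is
  nonempty, some original edge must contain a vertex of value 2, and this vertex also serves
  \<open>e\<close>.\<close>

lemma rhf_add_full_edge_iff:
  assumes "is_hypergraph H" "e \<notin> idx H" "idx H \<noteq> {}"
  shows "rhf (add_full_edge H e) (\<lambda>_. e) g \<longleftrightarrow>
    g \<in> verts H \<rightarrow>\<^sub>E {0, 1, 2} \<and> hitting_set H {x \<in> verts H. g x = 2}"
proof -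
  have "(\<exists>x\<in>verts H. g x = 2)" if hit: "\<forall>i\<in>idx H. \<exists>x\<in>edge H i. g x = 2"
  proof -
    obtain i where "i \<in> idx H" using assms(3) by blast
    with hit assms(1) show ?thesis unfolding is_hypergraph_def by blast
  qed
  moreover have "hitting_set H {x \<in> verts H. g x = 2} \<longleftrightarrow> (\<forall>i\<in>idx H. \<exists>x\<in>edge H i. g x = 2)"
    using assms(1) unfolding hitting_set_def is_hypergraph_def by blast
  moreover have "i \<noteq> e \<and> e \<noteq> i" if "i \<in> idx H" for i using that assms(2) by blast
  ultimately show ?thesis
    unfolding rhf_def add_full_edge_def by auto
qed

text \<open>On functions with values 0 and 2 the pointwise order is inclusion of the sets of value
  2, so the two notions of minimality agree as soon as minimal functions are known to avoid the
  value 1.\<close>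

lemma minimal_rhf_add_full_edge:
  assumes "is_hypergraph H" "e \<notin> idx H" "idx H \<noteq> {}"
  shows "{g. minimal_rhf (add_full_edge H e) (\<lambda>_. e) g} =
    twice_indicator H ` {S. minimal_hitting_set H S}"
proof -
  let ?G = "add_full_edge H e" and ?t = "\<lambda>_. e"
  have verts: "verts ?G = verts H" by (simp add: add_full_edge_def)
  note iff = rhf_add_full_edge_iff[OF assms]
  have two: "{x \<in> verts H. twice_indicator H S x = 2} = S" if "S \<subseteq> verts H" for S
    using that by (auto simp: twice_indicator_def)
  have rhf_twice: "rhf ?G ?t (twice_indicator H S) \<longleftrightarrow> hitting_set H S" if "S \<subseteq> verts H" for S
    unfolding iff two[OF that] by (auto simp: twice_indicator_def)
  show ?thesis
  proof (intro equalityI subsetI)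
    fix g assume "g \<in> {g. minimal_rhf ?G ?t g}"
    then have g: "rhf ?G ?t g"
      and min: "\<And>h. rhf ?G ?t h \<Longrightarrow> \<forall>x\<in>verts H. h x \<le> g x \<Longrightarrow> h = g"
      by (auto simp: minimal_rhf_def verts)
    define S where "S = {x \<in> verts H. g x = 2}"
    have S: "hitting_set H S" "S \<subseteq> verts H" using g by (auto simp: iff S_def)
    \<comment> \<open>Lowering every value 1 of \<open>g\<close> to 0 keeps the set of value 2,
      hence yields a smaller Roman hitting function; minimality makes it equal to
      \<open>g\<close>.\<close>
    have twice: "twice_indicator H S = g"
      using S by (intro min) (auto simp: rhf_twice, auto simp: twice_indicator_def S_def)
    have "\<not> hitting_set H T" if "T \<subset> S" for T
    proof
      assume "hitting_set H T"
      moreover have T: "T \<subseteq> verts H" using that S by blast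
      ultimately have "twice_indicator H T = g"
        using that by (intro min) (auto simp: rhf_twice, auto simp: twice_indicator_def S_def)
      with two[OF T] two[OF S(2)] that twice show False by auto
    qed
    with S twice show "g \<in> twice_indicator H ` {S. minimal_hitting_set H S}"
      by (auto simp: minimal_hitting_set_def)
  next
    fix g assume "g \<in> twice_indicator H ` {S. minimal_hitting_set H S}"
    then obtain S where g: "g = twice_indicator H S" and S: "hitting_set H S"
      and min: "\<And>T. T \<subset> S \<Longrightarrow> \<not> hitting_set H T"
      by (auto simp: minimal_hitting_set_def)
    have sub: "S \<subseteq> verts H" using S by (simp add: hitting_set_def)
    have "h = g" if h: "rhf ?G ?t h" and le: "\<forall>x\<in>verts H. h x \<le> g x" for h
    proof -
      have hE: "h \<in> verts H \<rightarrow>\<^sub>E {0, 1, 2}" and hit: "hitting_set H {x \<in> verts H. h x = 2}"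
        using h by (auto simp: iff)
      \<comment> \<open>Outside \<open>S\<close> the function \<open>g\<close> is 0, so
        \<open>h\<close> is 0 there too. Once minimality of \<open>S\<close> turns the inclusion
        into an equality, \<open>h\<close> is 2 on \<open>S\<close>.\<close>
      have "{x \<in> verts H. h x = 2} \<subseteq> S"
        using le by (auto simp: g twice_indicator_def split: if_splits)
      with hit min have eq: "{x \<in> verts H. h x = 2} = S" by blast
      show ?thesis
      proof
        fix x
        show "h x = g x"
        proof (cases "x \<in> verts H")
          case True
          with le have "h x \<le> g x" by blast
          with True eq show ?thesis
            by (cases "x \<in> S") (auto simp: g twice_indicator_def)
        next
          case False
          with hE show ?thesis by (auto simp: g twice_indicator_def)
        qed
      qed
    qed
    with rhf_twice[OF sub] S g show "g \<in> {g. minimal_rhf ?G ?t g}"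
      by (auto simp: minimal_rhf_def verts)
  qed
qed

lemma minimal_hitting_set_no_edges:
  assumes "idx H = {}"
  shows "minimal_hitting_set H S \<longleftrightarrow> S = {}"
  using assms by (auto simp: minimal_hitting_set_def hitting_set_def)

section \<open>The input word of the enlarged hypergraph\<close>

definition matrix_rows :: "nhypergraph \<Rightarrow> (nat \<Rightarrow> nat \<Rightarrow> bool) \<Rightarrow> word" where
  "matrix_rows H R =
     concat (map (\<lambda>i. map (\<lambda>x. if R i x then 1 else 0) (sorted_list_of_set (verts H)) @ [2])
       (sorted_list_of_set (idx H)))"

text \<open>Symbolwise passage from an incidence matrix to the zero matrix of the same shape,
  keeping the row ends. No vertex corresponds to an original index, so this gives the original rows
  of the matrix of the correspondence.\<close>

definition blank :: "nat \<Rightarrow> nat" where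
  "blank a = (if a = 2 then 2 else 0)"

lemma set_matrix_rows: "set (matrix_rows H R) \<subseteq> {0, 1, 2}"
  by (auto simp: matrix_rows_def)

lemma matrix_rows_eq_Nil_iff: "finite (idx H) \<Longrightarrow> matrix_rows H R = [] \<longleftrightarrow> idx H = {}"
  by (auto simp: matrix_rows_def)

lemma enc_matrix_eq: "enc_matrix H R = matrix_rows H R @ [3]"
  by (simp add: enc_matrix_def matrix_rows_def)

lemma enc_hypergraph_eq:
  "enc_hypergraph H =
     replicate (card (verts H)) 1 @ 2 # matrix_rows H (\<lambda>i x. x \<in> edge H i) @ [3]"
  by (simp add: enc_hypergraph_def enc_matrix_eq)

lemma matrix_rows_cong:
  assumes "is_hypergraph H" "\<And>i x. i \<in> idx H \<Longrightarrow> x \<in> verts H \<Longrightarrow> R i x \<longleftrightarrow> R' i x"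
  shows "matrix_rows H R = matrix_rows H R'"
  unfolding matrix_rows_def using assms
  by (intro arg_cong[of _ _ concat] map_cong arg_cong2[of _ _ _ _ append])
    (auto simp: is_hypergraph_def)

lemma map_blank_matrix_rows: "map blank (matrix_rows H R) = matrix_rows H (\<lambda>_ _. False)"
  by (auto simp: matrix_rows_def map_concat o_def blank_def intro!: arg_cong[of _ _ concat])

lemma sorted_list_of_set_insert_greater:
  fixes e :: nat
  assumes "finite I" "\<And>i. i \<in> I \<Longrightarrow> i < e"
  shows "sorted_list_of_set (insert e I) = sorted_list_of_set I @ [e]"
  using assms
  by (intro sorted_distinct_set_unique)
    (auto simp: sorted_append less_imp_le simp del: sorted_list_of_set_insert_remove)

text \<open>As \<open>e\<close> exceeds all other indices, its row is the last one; it consists of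
  ones in the incidence matrix as well as in the matrix of the correspondence.\<close>

lemma matrix_rows_add_full_edge:
  assumes "is_hypergraph H" "\<And>i. i \<in> idx H \<Longrightarrow> i < e" "\<And>x. x \<in> verts H \<Longrightarrow> R e x"
  shows "matrix_rows (add_full_edge H e) R =
    matrix_rows H R @ replicate (card (verts H)) 1 @ [2]"
proof -
  have fin: "finite (verts H)" "finite (idx H)" using assms(1) by (auto simp: is_hypergraph_def)
  have "map (\<lambda>x. if R e x then 1 else 0) (sorted_list_of_set (verts H)) =
      replicate (card (verts H)) (1::nat)"
    unfolding sorted_list_of_set.length_sorted_key_list_of_set[symmetric]
      map_replicate_const[symmetric]
    using fin assms(3) by (intro map_cong) auto
  then show ?thesis
    by (simp add: matrix_rows_def add_full_edge_def
        sorted_list_of_set_insert_greater[OF fin(2) assms(2)]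
        del: sorted_list_of_set_insert_remove map_eq_conv)
qed

text \<open>The value of \<open>e\<close> does not appear in the word, so a program can build it
  from the original input by copying alone.\<close>

lemma enc_hypergraph_corr_add_full_edge:
  assumes H: "is_hypergraph H" and less: "\<And>i. i \<in> idx H \<Longrightarrow> i < e"
  defines "n \<equiv> card (verts H)" and "rows \<equiv> matrix_rows H (\<lambda>i x. x \<in> edge H i)"
  shows "enc_hypergraph_corr (add_full_edge H e, \<lambda>_. e) =
    replicate n 1 @ 2 # rows @ replicate n 1 @ [2, 3] @
    map blank rows @ replicate n 1 @ [2, 3]"
proof -
  let ?G = "add_full_edge H e"
  have ne: "e \<noteq> i" if "i \<in> idx H" for i using less[OF that] by simp
  have "matrix_rows ?G (\<lambda>i x. x \<in> edge ?G i) =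
      matrix_rows H (\<lambda>i x. x \<in> edge ?G i) @ replicate n 1 @ [2]"
    unfolding n_def by (rule matrix_rows_add_full_edge[OF H less]) (auto simp: add_full_edge_def)
  moreover have "matrix_rows H (\<lambda>i x. x \<in> edge ?G i) = rows"
    unfolding rows_def using ne by (intro matrix_rows_cong[OF H]) (auto simp: add_full_edge_def)
  moreover have "matrix_rows ?G (\<lambda>i x. e = i) =
      matrix_rows H (\<lambda>i x. e = i) @ replicate n 1 @ [2]"
    unfolding n_def by (rule matrix_rows_add_full_edge[OF H less]) auto
  moreover have "matrix_rows H (\<lambda>i x. e = i) = map blank rows"
    unfolding rows_def map_blank_matrix_rows using ne by (intro matrix_rows_cong[OF H]) auto
  moreover have "card (verts ?G) = n" by (simp add: n_def add_full_edge_def)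
  ultimately show ?thesis
    by (simp add: enc_hypergraph_corr_def enc_hypergraph_eq enc_matrix_eq)
qed

section \<open>Translation of the output words\<close>

definition two_to_one :: "nat \<Rightarrow> nat" where
  "two_to_one a = (if a = 2 then 1 else 0)"

text \<open>Guarantees that translating the outputs creates no repetitions.\<close>

lemma inj_on_map_two_to_one: "inj_on (map two_to_one) {w. set w \<subseteq> {0, 2}}"
proof (rule inj_on_mapI)
  show "inj_on two_to_one (\<Union> (set ` {w. set w \<subseteq> {0, 2}}))"
    by (auto simp: inj_on_def two_to_one_def)
qed

lemma map_two_to_one_enc_fun:
  "is_hypergraph H \<Longrightarrow>
   map two_to_one (enc_fun (add_full_edge H e) (twice_indicator H S)) = enc_set H S"
  by (auto simp: enc_fun_def enc_set_def add_full_edge_def twice_indicator_def two_to_one_def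
      is_hypergraph_def)

lemma enc_fun_twice_indicator:
  assumes "is_hypergraph H"
  shows "set (enc_fun (add_full_edge H e) (twice_indicator H S)) \<subseteq> {0, 2}"
    and "length (enc_fun (add_full_edge H e) (twice_indicator H S)) = card (verts H)"
  using assms by (auto simp: enc_fun_def add_full_edge_def twice_indicator_def is_hypergraph_def)


section \<open>Programs without output\<close>

text \<open>\<open>B\<close> is only an upper bound on the number of steps, because the branches of
  a conditional may differ in length.\<close>

definition silent :: "prog \<Rightarrow> store \<Rightarrow> nat \<Rightarrow> store \<Rightarrow> bool" where
  "silent c s B s' \<longleftrightarrow> (\<exists>k\<le>B. exec c s (replicate k Tick) s')"

lemma silent_Seq:
  "silent c1 s B1 s1 \<Longrightarrow> silent c2 s1 B2 s2 \<Longrightarrow> silent (Seq c1 c2) s (B1 + B2) s2"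
  unfolding silent_def
proof (elim exE conjE)
  fix k l
  assume "k \<le> B1" "l \<le> B2" and "exec c1 s (replicate k Tick) s1" "exec c2 s1 (replicate l Tick) s2"
  then show "\<exists>k\<le>B1 + B2. exec (Seq c1 c2) s (replicate k Tick) s2"
    using exec_Seq by (intro exI[of _ "k + l"]) (auto simp: replicate_add)
qed

lemma silent_mono: "silent c s B s' \<Longrightarrow> B \<le> B' \<Longrightarrow> silent c s B' s'"
  unfolding silent_def by (meson le_trans)

text \<open>Programs without loops and outputs, whose effect and worst-case time are given by the
  recursive functions \<open>run\<close> and \<open>cost\<close>. Loop bodies can thus be evaluated
  by simplification. On \<open>While\<close> those two functions take dummy values.\<close>

fun straight :: "prog \<Rightarrow> bool" where
  "straight (Emit r) = False"
| "straight (While b c) = False"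
| "straight (Seq c d) = (straight c \<and> straight d)"
| "straight (Cond b c d) = (straight c \<and> straight d)"
| "straight c = True"

fun run :: "prog \<Rightarrow> store \<Rightarrow> store" where
  "run (Push r a) s = s(r := a # s r)"
| "run (Pop r) s = s(r := tl (s r))"
| "run (Seq c d) s = run d (run c s)"
| "run (Cond b c d) s = (if holds b s then run c s else run d s)"
| "run c s = s"

fun cost :: "prog \<Rightarrow> nat" where
  "cost (Seq c d) = cost c + cost d"
| "cost (Cond b c d) = Suc (max (cost c) (cost d))"
| "cost c = 1"

lemma silent_straight: "straight c \<Longrightarrow> silent c s (cost c) (run c s)"
proof (induction c arbitrary: s)
  case (Seq c d)
  then show ?case by (auto intro: silent_Seq)
next
  case (Cond b c d)
  show ?case
  proof (cases "holds b s")
    case True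
    from Cond obtain k where k: "k \<le> cost c" "exec c s (replicate k Tick) (run c s)"
      by (auto simp: silent_def)
    from exec_CondT[OF True k(2)] k(1) True show ?thesis
      by (auto simp: silent_def intro!: exI[of _ "Suc k"])
  next
    case False
    from Cond obtain k where k: "k \<le> cost d" "exec d s (replicate k Tick) (run d s)"
      by (auto simp: silent_def)
    from exec_CondF[OF False k(2)] k(1) False show ?thesis
      by (auto simp: silent_def intro!: exI[of _ "Suc k"])
  qed
qed (auto simp: silent_def intro!: exI[of _ "Suc 0"] exec.intros)

text \<open>A loop that consumes a word: in the store \<open>F us vs\<close> the loop has processed the prefix \<open>us\<close>
  and the suffix \<open>vs\<close> is left.\<close>

lemma silent_While_word:
  assumes c: "straight c"
    and step: "\<And>us a vs. w = us @ a # vs \<Longrightarrow>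
      holds b (F us (a # vs)) \<and> run c (F us (a # vs)) = F (us @ [a]) vs"
    and stop: "\<not> holds b (F w [])"
    and "s = F [] w" "s' = F w []" "length w * Suc (cost c) + 1 \<le> B"
  shows "silent (While b c) s B s'"
proof -
  have "silent (While b c) (F us vs) (length vs * Suc (cost c) + 1) (F w [])"
    if "w = us @ vs" for us vs
    using that
  proof (induction vs arbitrary: us)
    case Nil
    from exec_WhileF[OF stop, of c] Nil show ?case
      by (auto simp: silent_def intro!: exI[of _ "Suc 0"])
  next
    case (Cons a vs)
    have h: "holds b (F us (a # vs))" and r: "run c (F us (a # vs)) = F (us @ [a]) vs"
      using step Cons.prems by auto
    obtain k where k: "k \<le> cost c" "exec c (F us (a # vs)) (replicate k Tick) (F (us @ [a]) vs)"
      using silent_straight[OF c, of "F us (a # vs)"] r by (auto simp: silent_def)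
    have "silent (While b c) (F (us @ [a]) vs) (length vs * Suc (cost c) + 1) (F w [])"
      using Cons.prems by (intro Cons.IH) simp
    then obtain l where l: "l \<le> length vs * Suc (cost c) + 1"
      "exec (While b c) (F (us @ [a]) vs) (replicate l Tick) (F w [])"
      by (auto simp: silent_def)
    from exec_WhileT[OF h k(2) l(2)]
    have "exec (While b c) (F us (a # vs)) (replicate (Suc (k + l)) Tick) (F w [])"
      by (simp add: replicate_add)
    then show ?case
      unfolding silent_def using k(1) l(1) by (intro exI[of _ "Suc (k + l)"]) auto
  qed
  from this[of "[]" w] assms(4-6) show ?thesis by (auto intro: silent_mono)
qed


section \<open>Preparing the input\<close>

text \<open>Stack 1 collects the part of the new input that is copied verbatim, in reverse; stacks 2
  and 3 each keep the vertex count for one of the two rows of \<open>e\<close>.\<close>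

definition read_vertices :: prog where
  "read_vertices = While (Top 0 1) (Seq (Pop 0) (Seq (Push 1 1) (Seq (Push 2 1) (Push 3 1))))"

definition read_rows :: prog where
  "read_rows = While (Neg (Top 0 3))
     (Seq (Cond (Top 0 2) (Seq (Push 1 2) (Push 4 2))
        (Cond (Top 0 1) (Seq (Push 1 1) (Push 4 0)) (Seq (Push 1 0) (Push 4 0))))
      (Pop 0))"

definition push_each :: "nat \<Rightarrow> nat \<Rightarrow> nat \<Rightarrow> prog" where
  "push_each r t a = While (Neg (Empty r)) (Seq (Pop r) (Push t a))"

definition move :: "nat \<Rightarrow> nat \<Rightarrow> prog" where
  "move r t = While (Neg (Empty r))
     (Seq (Cond (Top r 2) (Push t 2) (Cond (Top r 1) (Push t 1) (Push t 0))) (Pop r))"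

lemma silent_read_vertices:
  assumes "s 0 = replicate n 1 @ v" "\<nexists>u. v = 1 # u"
  shows "silent read_vertices s (5 * n + 1)
    (s(0 := v, 1 := replicate n 1 @ s 1, 2 := replicate n 1 @ s 2, 3 := replicate n 1 @ s 3))"
proof -
  define F where "F us vs = s(0 := vs @ v, 1 := rev us @ s 1, 2 := rev us @ s 2, 3 := rev us @ s 3)"
    for us vs
  show ?thesis
    unfolding read_vertices_def
  proof (rule silent_While_word[where F = F and w = "replicate n 1"])
    fix us vs and a :: nat
    assume "replicate n 1 = us @ a # vs"
    then have "a = 1" by (metis in_set_conv_decomp in_set_replicate)
    then show "holds (Top 0 1) (F us (a # vs)) \<and>
        run (Seq (Pop 0) (Seq (Push 1 1) (Seq (Push 2 1) (Push 3 1)))) (F us (a # vs)) =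
          F (us @ [a]) vs"
      by (auto simp: F_def fun_eq_iff)
  next
    show "\<not> holds (Top 0 1) (F (replicate n 1) [])"
      using assms(2) by (simp add: F_def)
    show "s = F [] (replicate n 1)"
      using assms(1) by (auto simp: F_def)
  qed (auto simp: F_def)
qed

lemma silent_read_rows:
  assumes "s 0 = w @ 3 # v" "set w \<subseteq> {0, 1, 2}"
  shows "silent read_rows s (6 * length w + 1)
    (s(0 := 3 # v, 1 := rev w @ s 1, 4 := rev (map blank w) @ s 4))"
  unfolding read_rows_def using assms
  by (intro silent_While_word[where w = w and
        F = "\<lambda>us vs. s(0 := vs @ 3 # v, 1 := rev us @ s 1, 4 := rev (map blank us) @ s 4)"])
    (auto simp: fun_eq_iff blank_def)

lemma silent_push_each:
  assumes "r \<noteq> t"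
  shows "silent (push_each r t a) s (3 * length (s r) + 1)
    (s(r := [], t := replicate (length (s r)) a @ s t))"
  unfolding push_each_def using assms
  by (intro silent_While_word[where w = "s r" and
        F = "\<lambda>us vs. s(r := vs, t := replicate (length us) a @ s t)"])
    (auto simp: fun_eq_iff)

lemma silent_move:
  assumes "r \<noteq> t" "set (s r) \<subseteq> {0, 1, 2}"
  shows "silent (move r t) s (5 * length (s r) + 1) (s(r := [], t := rev (s r) @ s t))"
  unfolding move_def using assms
  by (intro silent_While_word[where w = "s r" and F = "\<lambda>us vs. s(r := vs, t := rev us @ s t)"])
    (auto simp: fun_eq_iff)

text \<open>The new input is pushed from its last symbol to its first. Stacks 1 and 4 hold their
  words reversed, and \<open>move\<close> reverses them again.\<close>

definition write_input :: prog where
  "write_input =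
     Seq (Seq (Pop 0) (Seq (Push 0 3) (Push 0 2)))
       (Seq (push_each 2 0 1) (Seq (move 4 0)
         (Seq (Seq (Push 0 3) (Push 0 2)) (Seq (push_each 3 0 1) (move 1 0)))))"

text \<open>All auxiliary stacks end up empty, so the final store is exactly an initial store, as
  the assumption on the given program requires.\<close>

lemma silent_write_input:
  assumes "s = (\<lambda>_. [])(0 := [3], 1 := rev u, 2 := replicate n 1, 3 := replicate n 1, 4 := rev v)"
    and "set u \<subseteq> {0, 1, 2}" "set v \<subseteq> {0, 1, 2}"
  shows "silent write_input s (6 * n + 5 * length u + 5 * length v + 9)
    (init (u @ replicate n 1 @ [2, 3] @ v @ replicate n 1 @ [2, 3]))"
proof -
  let ?s1 = "s(0 := [2, 3])"
  let ?s2 = "?s1(2 := [], 0 := replicate n 1 @ [2, 3])"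
  let ?s3 = "?s2(4 := [], 0 := v @ replicate n 1 @ [2, 3])"
  let ?s4 = "?s3(0 := [2, 3] @ v @ replicate n 1 @ [2, 3])"
  let ?s5 = "?s4(3 := [], 0 := replicate n 1 @ [2, 3] @ v @ replicate n 1 @ [2, 3])"
  let ?s6 = "init (u @ replicate n 1 @ [2, 3] @ v @ replicate n 1 @ [2, 3])"
  have 1: "silent (Seq (Pop 0) (Seq (Push 0 3) (Push 0 2))) s 3 ?s1"
    using silent_straight[of "Seq (Pop 0) (Seq (Push 0 3) (Push 0 2))" s] assms(1)
    by (simp add: numeral_3_eq_3)
  have 2: "silent (push_each 2 0 1) ?s1 (3 * n + 1) ?s2"
    using silent_push_each[of 2 0 1 ?s1] assms(1) by simp
  have 3: "silent (move 4 0) ?s2 (5 * length v + 1) ?s3"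
    using silent_move[of 4 0 ?s2] assms by simp
  have 4: "silent (Seq (Push 0 3) (Push 0 2)) ?s3 2 ?s4"
    using silent_straight[of "Seq (Push 0 3) (Push 0 2)" ?s3] by (simp add: numeral_2_eq_2)
  have 5: "silent (push_each 3 0 1) ?s4 (3 * n + 1) ?s5"
    using silent_push_each[of 3 0 1 ?s4] assms(1) by simp
  have 6: "silent (move 1 0) ?s5 (5 * length u + 1) ?s6"
  proof -
    have "?s5(1 := [], 0 := rev (?s5 1) @ ?s5 0) = ?s6"
      using assms(1) by (auto simp: init_def fun_eq_iff)
    then show ?thesis
      using silent_move[of 1 0 ?s5] assms by simp
  qed
  have "silent write_input s
      (3 + ((3 * n + 1) + ((5 * length v + 1) + (2 + ((3 * n + 1) + (5 * length u + 1)))))) ?s6"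
    unfolding write_input_def
    by (rule silent_Seq[OF 1 silent_Seq[OF 2 silent_Seq[OF 3 silent_Seq[OF 4 silent_Seq[OF 5 6]]]]])
  then show ?thesis by (rule silent_mono) simp
qed


section \<open>Converting the output\<close>

fun test_stack :: "test \<Rightarrow> nat" where
  "test_stack (Empty r) = r"
| "test_stack (Top r a) = r"
| "test_stack (Neg b) = test_stack b"

fun stacks :: "prog \<Rightarrow> nat set" where
  "stacks SKIP = {}"
| "stacks (Push r a) = {r}"
| "stacks (Pop r) = {r}"
| "stacks (Emit r) = {r}"
| "stacks (Seq c d) = stacks c \<union> stacks d"
| "stacks (Cond b c d) = {test_stack b} \<union> stacks c \<union> stacks d"
| "stacks (While b c) = {test_stack b} \<union> stacks c"

lemma finite_stacks: "finite (stacks c)"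
  by (induction c) auto

text \<open>The first loop reverses the word onto \<open>A\<close>. The second reverses it back,
  restoring \<open>r\<close> for the rest of the computation and building the translated word on
  \<open>B\<close>.\<close>

definition prepare_output :: "nat \<Rightarrow> nat \<Rightarrow> nat \<Rightarrow> prog" where
  "prepare_output A B r =
     Seq (While (Neg (Empty r)) (Seq (Cond (Top r 2) (Push A 2) (Push A 0)) (Pop r)))
       (While (Neg (Empty A))
         (Seq (Cond (Top A 2) (Seq (Push r 2) (Push B 1)) (Seq (Push r 0) (Push B 0))) (Pop A)))"

definition clear :: "nat \<Rightarrow> prog" where
  "clear r = While (Neg (Empty r)) (Pop r)"

text \<open>The leading \<open>SKIP\<close> supplies the step that matches the one of the original
  \<open>Emit\<close> when the traces are compared.\<close>

fun convert_output :: "nat \<Rightarrow> nat \<Rightarrow> prog \<Rightarrow> prog" where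
  "convert_output A B (Emit r) =
     Seq SKIP (Seq (prepare_output A B r) (Seq (Emit B) (clear B)))"
| "convert_output A B (Seq c d) = Seq (convert_output A B c) (convert_output A B d)"
| "convert_output A B (Cond b c d) = Cond b (convert_output A B c) (convert_output A B d)"
| "convert_output A B (While b c) = While b (convert_output A B c)"
| "convert_output A B c = c"

lemma silent_prepare_output:
  assumes "r \<noteq> A" "r \<noteq> B" "A \<noteq> B" "s A = []" "s B = []" "set (s r) \<subseteq> {0, 2}"
  shows "silent (prepare_output A B r) s (9 * length (s r) + 2) (s(B := map two_to_one (s r)))"
proof -
  let ?s1 = "s(r := [], A := rev (s r))"
  have "silent (While (Neg (Empty r)) (Seq (Cond (Top r 2) (Push A 2) (Push A 0)) (Pop r)))
      s (4 * length (s r) + 1) ?s1"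
    using assms
    by (intro silent_While_word[where w = "s r" and F = "\<lambda>us vs. s(r := vs, A := rev us)"])
      (auto simp: fun_eq_iff)
  moreover have "silent (While (Neg (Empty A))
         (Seq (Cond (Top A 2) (Seq (Push r 2) (Push B 1)) (Seq (Push r 0) (Push B 0))) (Pop A)))
      ?s1 (5 * length (s r) + 1) (s(B := map two_to_one (s r)))"
  proof -
    have "a = 0 \<or> a = 2" if "rev (s r) = us @ a # vs" for us a vs
      using assms(6) that by (metis in_set_conv_decomp set_rev insertE singletonD subsetD)
    then show ?thesis
      using assms
      by (intro silent_While_word[where w = "rev (s r)" and
          F = "\<lambda>us vs. s(A := vs, r := rev us, B := rev (map two_to_one us))"])
      (force simp: fun_eq_iff two_to_one_def rev_map)+
  qed
  ultimately show ?thesis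
    unfolding prepare_output_def by (auto dest: silent_Seq intro: silent_mono)
qed

lemma silent_clear: "silent (clear r) s (2 * length (s r) + 1) (s(r := []))"
  unfolding clear_def
  by (intro silent_While_word[where w = "s r" and F = "\<lambda>us vs. s(r := vs)"])
    (auto simp: fun_eq_iff)

section \<open>Traces with at most \<open>K\<close> extra steps before and after each output\<close>

inductive slowed :: "nat \<Rightarrow> event list \<Rightarrow> event list \<Rightarrow> bool" for K where
  slowed_Nil: "slowed K [] []"
| slowed_Tick: "slowed K tr tr' \<Longrightarrow> slowed K (Tick # tr) (Tick # tr')"
| slowed_Output: "k \<le> K \<Longrightarrow> l \<le> K \<Longrightarrow> slowed K tr tr' \<Longrightarrow>
    slowed K (Output w # tr)
      (replicate k Tick @ Output (map two_to_one w) # replicate l Tick @ tr')"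

lemma slowed_append:
  "slowed K tr1 tr1' \<Longrightarrow> slowed K tr2 tr2' \<Longrightarrow> slowed K (tr1 @ tr2) (tr1' @ tr2')"
  by (induction rule: slowed.induct) (auto intro: slowed.intros)

lemma outputs_append: "outputs (tr @ tr') = outputs tr @ outputs tr'"
  by (induction tr rule: outputs.induct) auto

lemma outputs_replicate_Tick: "outputs (replicate k Tick) = []"
  by (induction k) auto

lemma delays_from_replicate_Tick:
  "delays_from d (replicate k Tick @ tr) = delays_from (d + k) tr"
  by (induction k arbitrary: d) auto

lemma outputs_slowed: "slowed K tr tr' \<Longrightarrow> outputs tr' = map (map two_to_one) (outputs tr)"
  by (induction rule: slowed.induct) (auto simp: outputs_append outputs_replicate_Tick)

text \<open>Between two outputs at most \<open>K\<close> steps are added after the first and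
  \<open>K\<close> before the second. The lead \<open>b \<le> a + K\<close> covers the steps added
  since the last output; at the start it leaves room for preparing the input.\<close>

lemma delays_slowed:
  assumes "slowed K tr tr'" "\<forall>d\<in>set (delays_from a tr). d \<le> D" "b \<le> a + K"
  shows "\<forall>d\<in>set (delays_from b tr'). d \<le> D + 2 * K"
  using assms
proof (induction arbitrary: a b rule: slowed.induct)
  case slowed_Nil
  then show ?case by auto
next
  case (slowed_Tick tr tr')
  then show ?case using slowed_Tick.IH[of "Suc a" "Suc b"] by auto
next
  case (slowed_Output k l tr tr' w)
  then show ?case using slowed_Output.IH[of 0 l] by (auto simp: delays_from_replicate_Tick)
qed

text \<open>The original program never touches \<open>A\<close> and \<open>B\<close>, so both
  programs reach the same stores after each translated command. That \<open>A\<close> and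
  \<open>B\<close> are empty again is part of the claim because sequences and loops need it for
  their next piece.\<close>

lemma exec_convert_output:
  assumes "exec c s tr s'" "A \<noteq> B" "A \<notin> stacks c" "B \<notin> stacks c" "s A = []" "s B = []"
    and "\<forall>w\<in>set (outputs tr). set w \<subseteq> {0, 2} \<and> 9 * length w + 3 \<le> K"
  shows "s' A = [] \<and> s' B = [] \<and> (\<exists>tr'. exec (convert_output A B c) s tr' s' \<and> slowed K tr tr')"
  using assms
proof (induction rule: exec.induct)
  case (exec_Emit r s)
  then have w: "set (s r) \<subseteq> {0, 2}" "9 * length (s r) + 3 \<le> K" by auto
  let ?w = "map two_to_one (s r)"
  obtain k where k: "k \<le> 9 * length (s r) + 2"
    "exec (prepare_output A B r) s (replicate k Tick) (s(B := ?w))"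
    using silent_prepare_output[of r A B s] w exec_Emit.prems by (auto simp: silent_def)
  have "silent (clear B) (s(B := ?w)) (2 * length (s r) + 1) s"
    using silent_clear[of B "s(B := ?w)"] fun_upd_triv[of s B] exec_Emit.prems by simp
  then obtain l where l: "l \<le> 2 * length (s r) + 1"
    "exec (clear B) (s(B := ?w)) (replicate l Tick) s"
    by (auto simp: silent_def)
  have "exec (convert_output A B (Emit r)) s
      ([Tick] @ replicate k Tick @ [Tick, Output ((s(B := ?w)) B)] @ replicate l Tick) s"
    unfolding convert_output.simps
    by (rule exec.exec_Seq[OF exec_SKIP exec.exec_Seq[OF k(2) exec.exec_Seq[OF exec.exec_Emit l(2)]]])
  then have "exec (convert_output A B (Emit r)) s
      (Tick # replicate (Suc k) Tick @ Output ?w # replicate l Tick @ []) s"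
    by (simp add: replicate_app_Cons_same)
  \<comment> \<open>\<open>Suc k\<close> also counts the step of \<open>Emit B\<close>, whence the 3
    in the bound \<open>9 * length w + 3\<close>.\<close>
  moreover have "slowed K [Tick, Output (s r)]
      (Tick # replicate (Suc k) Tick @ Output ?w # replicate l Tick @ [])"
    using k(1) l(1) w(2) by (intro slowed.intros) auto
  ultimately show ?case using exec_Emit.prems by blast
next
  case (exec_Seq c1 s tr1 s1 c2 tr2 s2)
  then obtain tr1' tr2' where "exec (convert_output A B c1) s tr1' s1" "slowed K tr1 tr1'"
    "exec (convert_output A B c2) s1 tr2' s2" "slowed K tr2 tr2'" "s2 A = []" "s2 B = []"
    by (auto simp: outputs_append)
  then show ?case by (auto intro!: exec.intros slowed_append exI[of _ "tr1' @ tr2'"])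
next
  case (exec_CondT b s c1 tr s1 c2)
  then obtain tr' where "exec (convert_output A B c1) s tr' s1" "slowed K tr tr'"
    "s1 A = []" "s1 B = []"
    by auto
  with exec_CondT.hyps(1) show ?case
    by (auto intro!: exec.exec_CondT slowed_Tick exI[of _ "Tick # tr'"])
next
  case (exec_CondF b s c2 tr s1 c1)
  then obtain tr' where "exec (convert_output A B c2) s tr' s1" "slowed K tr tr'"
    "s1 A = []" "s1 B = []"
    by auto
  with exec_CondF.hyps(1) show ?case
    by (auto intro!: exec.exec_CondF slowed_Tick exI[of _ "Tick # tr'"])
next
  case (exec_WhileT b s c tr1 s1 tr2 s2)
  then obtain tr1' tr2' where "exec (convert_output A B c) s tr1' s1" "slowed K tr1 tr1'"
    "exec (convert_output A B (While b c)) s1 tr2' s2" "slowed K tr2 tr2'"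
    "s2 A = []" "s2 B = []"
    by (auto simp: outputs_append)
  with exec_WhileT.hyps(1) show ?case
    by (auto intro!: exec.exec_WhileT slowed_Tick slowed_append exI[of _ "Tick # tr1' @ tr2'"])
qed (auto intro!: exec.intros slowed.intros exI[of _ "[Tick]"])


section \<open>The enumeration algorithm for minimal hitting sets\<close>

lemma poly_nat_mono:
  fixes p :: "nat poly"
  shows "x \<le> y \<Longrightarrow> poly p x \<le> poly p y"
  by (induction p) (simp_all add: mult_le_mono)

text \<open>After the header, a 3 on top means that there are no rows, since every row ends with a
  2, even without vertices. The word of zeros then encodes the empty set.\<close>

definition enumerate_hitting_sets :: "nat \<Rightarrow> nat \<Rightarrow> prog \<Rightarrow> prog" where
  "enumerate_hitting_sets A B c =
     Seq (Seq read_vertices (Seq (Pop 0) (Push 1 2)))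
       (Cond (Top 0 3)
         (Seq (push_each 2 4 0) (Emit 4))
         (Seq (Seq read_rows write_input) (convert_output A B c)))"

lemma silent_read_header:
  "silent (Seq read_vertices (Seq (Pop 0) (Push 1 2))) (init (replicate n 1 @ 2 # v)) (5 * n + 3)
    ((\<lambda>_. [])(0 := v, 1 := 2 # replicate n 1, 2 := replicate n 1, 3 := replicate n 1))"
  (is "silent _ ?s _ ?s2")
proof -
  let ?s1 = "(\<lambda>_. [])(0 := 2 # v, 1 := replicate n 1, 2 := replicate n 1, 3 := replicate n 1)"
  have "silent read_vertices ?s (5 * n + 1) ?s1"
    using silent_read_vertices[of ?s n "2 # v"] by (simp add: init_def)
  moreover have "run (Seq (Pop 0) (Push 1 2)) ?s1 = ?s2"
    by (auto simp: fun_eq_iff)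
  then have "silent (Seq (Pop 0) (Push 1 2)) ?s1 2 ?s2"
    using silent_straight[of "Seq (Pop 0) (Push 1 2)" ?s1] by (simp add: numeral_2_eq_2)
  ultimately have "silent (Seq read_vertices (Seq (Pop 0) (Push 1 2))) ?s (5 * n + 1 + 2) ?s2"
    by (rule silent_Seq)
  then show ?thesis by (rule silent_mono) simp
qed

lemma exec_enumerate_no_edges:
  "\<exists>k s'. k \<le> 8 * n + 6 \<and>
     exec (enumerate_hitting_sets A B c) (init (replicate n 1 @ [2, 3]))
       (replicate k Tick @ [Output (replicate n 0)]) s'"
proof -
  let ?s1 = "(\<lambda>_::nat. [])(0 := [3], 1 := 2 # replicate n 1, 2 := replicate n 1, 3 := replicate n 1)"
  let ?s2 = "?s1(2 := [], 4 := replicate n 0)"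
  obtain k where k: "k \<le> 5 * n + 3" "exec (Seq read_vertices (Seq (Pop 0) (Push 1 2)))
      (init (replicate n 1 @ [2, 3])) (replicate k Tick) ?s1"
    using silent_read_header[of n "[3]"] by (auto simp: silent_def)
  obtain l where l: "l \<le> 3 * n + 1" "exec (push_each 2 4 0) ?s1 (replicate l Tick) ?s2"
    using silent_push_each[of 2 4 0 ?s1] by (auto simp: silent_def)
  have "holds (Top 0 3) ?s1" by simp
  from exec_Seq[OF k(2) exec_CondT[OF this exec_Seq[OF l(2) exec_Emit]]]
  have "exec (enumerate_hitting_sets A B c) (init (replicate n 1 @ [2, 3]))
      (replicate k Tick @ Tick # replicate l Tick @ [Tick, Output (?s2 4)]) ?s2"
    unfolding enumerate_hitting_sets_def .
  moreover have "replicate k Tick @ Tick # replicate l Tick @ [Tick, Output (?s2 4)] =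
      replicate (k + l + 2) Tick @ [Output (replicate n 0)]"
    by (simp add: replicate_add replicate_app_Cons_same)
  ultimately have "exec (enumerate_hitting_sets A B c) (init (replicate n 1 @ [2, 3]))
      (replicate (k + l + 2) Tick @ [Output (replicate n 0)]) ?s2"
    by (simp only:)
  moreover have "k + l + 2 \<le> 8 * n + 6" using k(1) l(1) by simp
  ultimately show ?thesis by blast
qed

lemma exec_enumerate_edges:
  assumes "set rows \<subseteq> {0, 1, 2}" "rows \<noteq> []"
    and c: "exec (convert_output A B c) (init (replicate n 1 @ 2 # rows @ replicate n 1 @ [2, 3] @
      map blank rows @ replicate n 1 @ [2, 3])) tr s'"
  shows "\<exists>k \<le> 16 * n + 16 * length rows + 19.
    exec (enumerate_hitting_sets A B c) (init (replicate n 1 @ 2 # rows @ [3]))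
      (replicate k Tick @ tr) s'"
proof -
  let ?s1 = "(\<lambda>_::nat. [])(0 := rows @ [3], 1 := 2 # replicate n 1, 2 := replicate n 1,
    3 := replicate n 1)"
  let ?s2 = "(\<lambda>_::nat. [])(0 := [3], 1 := rev (replicate n 1 @ 2 # rows), 2 := replicate n 1,
    3 := replicate n 1, 4 := rev (map blank rows))"
  let ?s3 = "init ((replicate n 1 @ 2 # rows) @ replicate n 1 @ [2, 3] @
      map blank rows @ replicate n 1 @ [2, 3])"
  obtain k where k: "k \<le> 5 * n + 3" "exec (Seq read_vertices (Seq (Pop 0) (Push 1 2)))
      (init (replicate n 1 @ 2 # rows @ [3])) (replicate k Tick) ?s1"
    using silent_read_header[of n "rows @ [3]"] by (auto simp: silent_def)
  have "?s1(0 := [3], 1 := rev rows @ ?s1 1, 4 := rev (map blank rows) @ ?s1 4) = ?s2"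
    by (auto simp: fun_eq_iff)
  moreover have "silent read_rows ?s1 (6 * length rows + 1)
      (?s1(0 := [3], 1 := rev rows @ ?s1 1, 4 := rev (map blank rows) @ ?s1 4))"
    using assms(1) by (intro silent_read_rows) simp_all
  ultimately have "silent read_rows ?s1 (6 * length rows + 1) ?s2" by (simp only:)
  moreover have "silent write_input ?s2
      (6 * n + 5 * length (replicate n 1 @ 2 # rows) + 5 * length (map blank rows) + 9) ?s3"
    using assms(1) by (intro silent_write_input refl) (auto simp: blank_def)
  ultimately have "silent (Seq read_rows write_input) ?s1 (11 * n + 16 * length rows + 15) ?s3"
    by (rule silent_mono[OF silent_Seq]) simp
  then obtain l where l: "l \<le> 11 * n + 16 * length rows + 15"
    "exec (Seq read_rows write_input) ?s1 (replicate l Tick) ?s3"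
    by (auto simp: silent_def)
  have "\<not> holds (Top 0 3) ?s1" using assms(1,2) by (cases rows) auto
  from exec_Seq[OF k(2) exec_CondF[OF this exec_Seq[OF l(2)]]] c
  have "exec (enumerate_hitting_sets A B c) (init (replicate n 1 @ 2 # rows @ [3]))
      (replicate k Tick @ Tick # replicate l Tick @ tr) s'"
    unfolding enumerate_hitting_sets_def by simp
  moreover have "replicate k Tick @ Tick # replicate l Tick @ tr =
      replicate (Suc (k + l)) Tick @ tr"
    by (simp add: replicate_add replicate_app_Cons_same)
  ultimately have "exec (enumerate_hitting_sets A B c) (init (replicate n 1 @ 2 # rows @ [3]))
      (replicate (Suc (k + l)) Tick @ tr) s'"
    by (simp only:)
  moreover have "Suc (k + l) \<le> 16 * n + 16 * length rows + 19" using k(1) l(1) by simp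
  ultimately show ?thesis by blast
qed

theorem theorem20:
  assumes "\<exists>c. poly_delay_enumerates_minimal_rhfs c"
  shows "\<exists>c'. poly_delay_enumerates_minimal_hitting_sets c'"
proof -
  obtain c and p :: "nat poly" where c: "\<And>H \<tau>. is_hypergraph H \<Longrightarrow> correspondence H \<tau> \<Longrightarrow>
      \<exists>tr s'. exec c (init (enc_hypergraph_corr (H, \<tau>))) tr s' \<and> distinct (outputs tr) \<and>
        set (outputs tr) = enc_fun H ` {g. minimal_rhf H \<tau> g} \<and>
        (\<forall>d\<in>set (delays tr). d \<le> poly p (length (enc_hypergraph_corr (H, \<tau>))))"
    using assms unfolding poly_delay_enumerates_minimal_rhfs_def enumerates_poly_delay_def by fast
  obtain m where m: "\<And>r. r \<in> stacks c \<Longrightarrow> r < m"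
    using finite_stacks[of c] by (auto simp: finite_nat_set_iff_bounded)
  \<comment> \<open>Starting at \<open>Suc m\<close> rather than \<open>m\<close> also avoids the
    input stack 0 when \<open>m = 0\<close>.\<close>
  define A B where "A = Suc m" and "B = Suc (Suc m)"
  have AB: "A \<noteq> B" "A \<notin> stacks c" "B \<notin> stacks c" "init w A = []" "init w B = []" for w
    using m[of A] m[of B] by (auto simp: A_def B_def init_def)
  let ?c = "enumerate_hitting_sets A B c"
  \<comment> \<open>The new input has length at most \<open>4 * L + 4\<close> for an input of length
    \<open>L\<close>. The linear term covers twice the extra delay \<open>20 * L\<close> and,
    without edges, the whole running time.\<close>
  define q where "q = pcompose p [:4, 4:] + [:40, 40:]"
  have "\<exists>tr s'. exec ?c (init (enc_hypergraph H)) tr s' \<and> distinct (outputs tr) \<and>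
      set (outputs tr) = enc_set H ` {S. minimal_hitting_set H S} \<and>
      (\<forall>d\<in>set (delays tr). d \<le> poly q (length (enc_hypergraph H)))"
    if H: "is_hypergraph H" for H
  proof -
    have fin: "finite (idx H)" using H by (simp add: is_hypergraph_def)
    define n rows where "n = card (verts H)" and "rows = matrix_rows H (\<lambda>i x. x \<in> edge H i)"
    have enc: "enc_hypergraph H = replicate n 1 @ 2 # rows @ [3]"
      by (simp add: enc_hypergraph_eq n_def rows_def)
    define L where "L = length (enc_hypergraph H)"
    have L: "L = n + length rows + 2" by (simp add: L_def enc)
    have q: "poly q L = poly p (4 * L + 4) + 40 * L + 40"
      by (simp add: q_def poly_pcompose algebra_simps)
    show ?thesis
    proof (cases "idx H = {}")
      case True
      then have rows: "rows = []" by (simp add: rows_def matrix_rows_eq_Nil_iff[OF fin])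
      obtain k s' where k: "k \<le> 8 * n + 6"
        "exec ?c (init (enc_hypergraph H)) (replicate k Tick @ [Output (replicate n 0)]) s'"
        using exec_enumerate_no_edges[of n A B c] by (auto simp: enc rows)
      have "enc_set H ` {S. minimal_hitting_set H S} = {replicate n 0}"
        by (simp add: minimal_hitting_set_no_edges[OF True] enc_set_def n_def map_replicate_const)
      moreover have "delays (replicate k Tick @ [Output (replicate n 0)]) = [k, 0]"
        by (simp add: delays_def delays_from_replicate_Tick)
      ultimately show ?thesis
        using k L unfolding L_def[symmetric] q
        by (intro exI[of _ "replicate k Tick @ [Output (replicate n 0)]"] exI[of _ s'])
          (auto simp: outputs_append outputs_replicate_Tick)
    next
      case False
      obtain e where e: "\<And>i. i \<in> idx H \<Longrightarrow> i < e"
        using fin by (auto simp: finite_nat_set_iff_bounded)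
      let ?G = "add_full_edge H e"
      have "e \<notin> idx H" using e by blast
      note sols = minimal_rhf_add_full_edge[OF H this False]
      define E where "E = enc_hypergraph_corr (?G, \<lambda>_. e)"
      have E: "E = replicate n 1 @ 2 # rows @ replicate n 1 @ [2, 3] @
          map blank rows @ replicate n 1 @ [2, 3]"
        unfolding E_def n_def rows_def by (rule enc_hypergraph_corr_add_full_edge[OF H e])
      obtain tr s' where tr: "exec c (init E) tr s'" "distinct (outputs tr)"
        "set (outputs tr) = enc_fun ?G ` twice_indicator H ` {S. minimal_hitting_set H S}"
        "\<forall>d\<in>set (delays_from 0 tr). d \<le> poly p (length E)"
        using c[OF is_hypergraph_add_full_edge[OF H] correspondence_add_full_edge, of e]
        unfolding sols E_def[symmetric] delays_def by blast
      \<comment> \<open>Large enough both for translating a word of length \<open>n\<close> and for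
        the preparation, as \<open>16 * n + 16 * length rows + 19 \<le> 20 * L\<close>.\<close>
      define K where "K = 20 * L"
      have words: "set w \<subseteq> {0, 2} \<and> length w = n" if "w \<in> set (outputs tr)" for w
        using that enc_fun_twice_indicator[OF H] by (auto simp: tr(3) n_def)
      then have "\<forall>w\<in>set (outputs tr). set w \<subseteq> {0, 2} \<and> 9 * length w + 3 \<le> K"
        by (auto simp: K_def L)
      with exec_convert_output[OF tr(1)] AB obtain tr' where
        tr': "exec (convert_output A B c) (init E) tr' s'" "slowed K tr tr'"
        by blast
      have "set rows \<subseteq> {0, 1, 2}" "rows \<noteq> []"
        unfolding rows_def using False set_matrix_rows
        by (simp_all only: matrix_rows_eq_Nil_iff[OF fin] not_False_eq_True)
      from exec_enumerate_edges[OF this tr'(1)[unfolded E]]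
      obtain k where k: "k \<le> 16 * n + 16 * length rows + 19"
        "exec ?c (init (enc_hypergraph H)) (replicate k Tick @ tr') s'"
        unfolding enc by blast
      have out: "outputs (replicate k Tick @ tr') = map (map two_to_one) (outputs tr)"
        by (simp add: outputs_append outputs_replicate_Tick outputs_slowed[OF tr'(2)])
      have "inj_on (map two_to_one) (set (outputs tr))"
        by (rule inj_on_subset[OF inj_on_map_two_to_one]) (use words in auto)
      then have "distinct (outputs (replicate k Tick @ tr'))"
        using tr(2) by (simp add: out distinct_map)
      moreover have "set (outputs (replicate k Tick @ tr')) =
          enc_set H ` {S. minimal_hitting_set H S}"
        by (simp add: out tr(3) image_image map_two_to_one_enc_fun[OF H])
      moreover have "\<forall>d\<in>set (delays (replicate k Tick @ tr')). d \<le> poly q L"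
      proof -
        \<comment> \<open>The preparation counts as a lead of \<open>k\<close> steps before the
          first output.\<close>
        have "k \<le> 0 + K" using k(1) by (simp add: K_def L)
        from delays_slowed[OF tr'(2) tr(4) this]
        have "\<forall>d\<in>set (delays_from k tr'). d \<le> poly p (length E) + 2 * K" .
        moreover have "poly p (length E) \<le> poly p (4 * L + 4)"
          by (rule poly_nat_mono) (simp add: E L)
        ultimately show ?thesis
          unfolding q by (force simp: delays_def delays_from_replicate_Tick K_def)
      qed
      ultimately show ?thesis using k(2) unfolding L_def by blast
    qed
  qed
  then have "poly_delay_enumerates_minimal_hitting_sets ?c"
    unfolding poly_delay_enumerates_minimal_hitting_sets_def enumerates_poly_delay_def by blast
  then show ?thesis by blast
qed

end
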